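(* Let $n,m\ge 2$ be integers, let $L=\partial^n+u_2\partial^{n-2}+\cdots+u_{n-1}\partial+u_n$ and $\tilde P_m=\partial^m+y_2\partial^{m-2}+\cdots+y_{m-1}\partial+y_m$, and let $E_{m,k}(U,Y_m)$ be the coefficient of $\partial^k$ in $[L,\tilde P_m]$. Then the system $$\mathbb{E}_{m,n}:\quad E_{m,n+m-i}(U,Y_m)=0,\qquad i=3,\ldots,m+1,$$ has a unique solution $Z=\{q_2,\ldots,q_m\}\subset\mathbb{Q}\{U\}$ in the variables $Y_m$ with weights $w(q_\ell)=\ell$ for $\ell=2,\ldots,m$.
   Context: $U=\{u_2,\ldots,u_n\}$ and $Y_m=\{y_2,\ldots,y_m\}$ are sets of independent differential variables. $\mathbb{Q}\{U\}$ is the ring of differential polynomials, i.e. the polynomial ring over $\mathbb{Q}$ in the variables $u_\ell^{(k)}$ ($k\ge0$), with derivation $\partial$ vanishing on $\mathbb{Q}$ and $\partial(u_\ell^{(k)})=u_\ell^{(k+1)}$; similarly $\mathbb{Q}\{U,Y_m\}$ has in addition the variables $y_\ell^{(k)}$ with $\partial(y_\ell^{(k)})=y_\ell^{(k+1)}$. For a differential ring $S$, $S[\partial]$ is the ring of differential operators with $\partial s=s\partial+\partial(s)$, and $[A,B]=AB-BA$, here computed in $\mathbb{Q}\{U,Y_m\}[\partial]$. The weight on $\mathbb{Q}\{U\}$ is the grading determined by $w(u_\ell^{(k)})=\ell+k$; the condition $w(q_\ell)=\ell$ means that $q_\ell$ is homogeneous of weight $\ell$ (the zero polynomial being regarded as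 homogeneous of every weight). $Z=\{q_2,\ldots,q_m\}$ (an indexed family, $q_\ell$ corresponding to $y_\ell$) is a solution in the variables $Y_m$ if each equation holds after substituting $y_\ell^{(k)}\mapsto \partial^k(q_\ell)$ for all $\ell,k$. *)

theory Defs
  imports
    Complex_Main
    "HOL-Library.Poly_Mapping"
    "HOL-Library.FuncSet"
    "HOL-Computational_Algebra.Polynomial"
begin
text \<open>
  \<open>U l k\<close> and \<open>Y l k\<close> stand for the \<open>k\<close>-th derivatives of the differential variables \<open>u\<^sub>l\<close>
  and \<open>y\<^sub>l\<close>. The variables for all \<open>l\<close> live in one ambient polynomial ring; the ring of
  differential polynomials in \<open>u\<^sub>2, \<dots>, u\<^sub>n\<close> is the subset \<open>dpolys_U n\<close> below.
\<close>

datatype dvar = U nat nat | Y nat nat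

type_synonym monomial = "dvar \<Rightarrow>\<^sub>0 nat"

type_synonym dpoly = "monomial \<Rightarrow>\<^sub>0 rat"

definition var :: "dvar \<Rightarrow> dpoly" where
  "var x = Poly_Mapping.single (Poly_Mapping.single x 1) 1"

definition const :: "rat \<Rightarrow> dpoly" where
  "const c = Poly_Mapping.single 0 c"

definition dpolys_U :: "nat \<Rightarrow> dpoly set" where
  "dpolys_U n = {p. \<forall>t\<in>Poly_Mapping.keys p. Poly_Mapping.keys t \<subseteq> {U l k |l k. 2 \<le> l \<and> l \<le> n}}"

fun next_var :: "dvar \<Rightarrow> dvar" where
  "next_var (U l k) = U l (Suc k)"
| "next_var (Y l k) = Y l (Suc k)"

text \<open>
  The derivation is the sum over all variables \<open>x\<close> of \<open>next_var x\<close> times the partial derivative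
  by \<open>x\<close>, written out on monomials: in each monomial \<open>t\<close> one factor \<open>x\<close> is replaced by
  \<open>next_var x\<close>, with multiplicity the exponent of \<open>x\<close> in \<open>t\<close>.
\<close>

definition D_monomial :: "monomial \<Rightarrow> rat \<Rightarrow> dpoly" where
  "D_monomial t c = (\<Sum>x\<in>Poly_Mapping.keys t.
     Poly_Mapping.single (t - Poly_Mapping.single x 1 + Poly_Mapping.single (next_var x) 1)
       (c * of_nat (Poly_Mapping.lookup t x)))"

definition D :: "dpoly \<Rightarrow> dpoly" where
  "D p = (\<Sum>t\<in>Poly_Mapping.keys p. D_monomial t (Poly_Mapping.lookup p t))"

fun var_weight :: "dvar \<Rightarrow> nat" where
  "var_weight (U l k) = l + k"
| "var_weight (Y l k) = l + k"

definition monomial_weight :: "monomial \<Rightarrow> nat" where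
  "monomial_weight t = (\<Sum>x\<in>Poly_Mapping.keys t. Poly_Mapping.lookup t x * var_weight x)"

definition homogeneous_of_weight :: "nat \<Rightarrow> dpoly \<Rightarrow> bool" where
  "homogeneous_of_weight w p \<longleftrightarrow> (\<forall>t\<in>Poly_Mapping.keys p. monomial_weight t = w)"

definition eval_monomial :: "(dvar \<Rightarrow> dpoly) \<Rightarrow> monomial \<Rightarrow> rat \<Rightarrow> dpoly" where
  "eval_monomial \<sigma> t c =
     const c * (\<Prod>x\<in>Poly_Mapping.keys t. \<sigma> x ^ Poly_Mapping.lookup t x)"

definition eval_dpoly :: "(dvar \<Rightarrow> dpoly) \<Rightarrow> dpoly \<Rightarrow> dpoly" where
  "eval_dpoly \<sigma> p = (\<Sum>t\<in>Poly_Mapping.keys p. eval_monomial \<sigma> t (Poly_Mapping.lookup p t))"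

fun subst_Y_var :: "(nat \<Rightarrow> dpoly) \<Rightarrow> dvar \<Rightarrow> dpoly" where
  "subst_Y_var q (U l k) = var (U l k)"
| "subst_Y_var q (Y l k) = (D ^^ k) (q l)"

definition subst_Y :: "(nat \<Rightarrow> dpoly) \<Rightarrow> dpoly \<Rightarrow> dpoly" where
  "subst_Y q = eval_dpoly (subst_Y_var q)"

text \<open>
  The operator \<open>\<Sum>\<^sub>i a\<^sub>i \<partial>\<^sup>i\<close> over a ring \<open>'a\<close> with derivation \<open>\<delta>\<close> is represented by the polynomial
  with coefficients \<open>a\<^sub>i\<close>. Only the additive structure of \<^typ>\<open>'a poly\<close> is that of the ring of
  operators; its commutative product is not used. The rule \<open>\<partial> s = s \<partial> + \<delta> s\<close> determines left
  multiplication by \<open>\<partial>\<close>, and thereby the product.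
\<close>

definition d_times :: "('a::comm_ring_1 \<Rightarrow> 'a) \<Rightarrow> 'a poly \<Rightarrow> 'a poly" where
  "d_times \<delta> B = pCons 0 B + map_poly \<delta> B"

definition op_mult :: "('a::comm_ring_1 \<Rightarrow> 'a) \<Rightarrow> 'a poly \<Rightarrow> 'a poly \<Rightarrow> 'a poly" where
  "op_mult \<delta> A B = (\<Sum>i\<le>degree A. smult (coeff A i) ((d_times \<delta> ^^ i) B))"

definition op_commutator :: "('a::comm_ring_1 \<Rightarrow> 'a) \<Rightarrow> 'a poly \<Rightarrow> 'a poly \<Rightarrow> 'a poly" where
  "op_commutator \<delta> A B = op_mult \<delta> A B - op_mult \<delta> B A"

definition L_op :: "nat \<Rightarrow> dpoly poly" where
  "L_op n = monom 1 n + (\<Sum>l\<in>{2..n}. monom (var (U l 0)) (n - l))"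

definition P_op :: "nat \<Rightarrow> dpoly poly" where
  "P_op m = monom 1 m + (\<Sum>l\<in>{2..m}. monom (var (Y l 0)) (m - l))"

definition E_coeff :: "nat \<Rightarrow> nat \<Rightarrow> nat \<Rightarrow> dpoly" where
  "E_coeff n m k = coeff (op_commutator D (L_op n) (P_op m)) k"

definition sum_terms :: "('m \<Rightarrow> 'c \<Rightarrow> 'b) \<Rightarrow> ('m \<Rightarrow>\<^sub>0 'c::comm_ring_1) \<Rightarrow> 'b::comm_ring_1" where
  "sum_terms F p = (\<Sum>t\<in>Poly_Mapping.keys p. F t (Poly_Mapping.lookup p t))"

lemma sum_terms_superset:
  assumes "\<And>t. F t 0 = 0" "finite A" "Poly_Mapping.keys p \<subseteq> A"
  shows "sum_terms F p = (\<Sum>t\<in>A. F t (Poly_Mapping.lookup p t))"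
  unfolding sum_terms_def
  by (rule sum.mono_neutral_left) (use assms in \<open>auto simp: in_keys_iff\<close>)

lemma sum_terms_add:
  assumes 0: "\<And>t. F t 0 = 0" and add: "\<And>t a b. F t (a + b) = F t a + F t b"
  shows "sum_terms F (p + q) = sum_terms F p + sum_terms F q"
proof -
  let ?A = "Poly_Mapping.keys p \<union> Poly_Mapping.keys q"
  have "Poly_Mapping.keys (p + q) \<subseteq> ?A" by (rule Poly_Mapping.keys_add)
  then show ?thesis
    by (subst (1 2 3) sum_terms_superset[of F ?A, OF 0]) (auto simp: lookup_add add sum.distrib)
qed

lemma sum_terms_single:
  assumes "\<And>t. F t 0 = 0"
  shows "sum_terms F (Poly_Mapping.single t c) = F t c"
  by (subst sum_terms_superset[of F "{t}"]) (use assms in auto)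

lemma poly_mapping_single_add_induct [case_names single add]:
  fixes p :: "'m \<Rightarrow>\<^sub>0 'c::comm_monoid_add"
  assumes "\<And>t c. P (Poly_Mapping.single t c)" "\<And>p q. P p \<Longrightarrow> P q \<Longrightarrow> P (p + q)"
  shows "P p"
proof -
  have eq: "p = (\<Sum>t\<in>Poly_Mapping.keys p. Poly_Mapping.single t (Poly_Mapping.lookup p t))"
    by (rule poly_mapping_eqI) (auto simp: lookup_sum lookup_single when_def in_keys_iff)
  have "P (\<Sum>t\<in>A. Poly_Mapping.single t (Poly_Mapping.lookup p t))" if "finite A" for A
    using that
  proof induction
    case empty
    show ?case using assms(1)[of undefined 0] by simp
  next
    case (insert x A)
    then show ?case using assms by simp
  qed
  then show ?thesis by (subst eq) simp
qed

lemma D_monomial_0 [simp]: "D_monomial t 0 = 0"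
  by (simp add: D_monomial_def)

lemma D_monomial_add: "D_monomial t (a + b) = D_monomial t a + D_monomial t b"
  by (simp add: D_monomial_def distrib_right single_add sum.distrib)

lemma D_conv_sum_terms: "D = sum_terms D_monomial"
  by (rule ext) (simp add: D_def sum_terms_def)

lemma D_add: "D (p + q) = D p + D q"
  unfolding D_conv_sum_terms by (rule sum_terms_add) (simp_all add: D_monomial_add)

lemma D_single: "D (Poly_Mapping.single t c) = D_monomial t c"
  unfolding D_conv_sum_terms by (rule sum_terms_single) simp

lemma D_const [simp]: "D (const c) = 0"
  by (simp add: const_def D_single D_monomial_def)

lemma D_var [simp]: "D (var x) = var (next_var x)"
  by (simp add: var_def D_single D_monomial_def)

lemma D_monomial_superset:
  assumes "finite A" "Poly_Mapping.keys t \<subseteq> A"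
  shows "D_monomial t c = (\<Sum>x\<in>A.
     Poly_Mapping.single (t - Poly_Mapping.single x 1 + Poly_Mapping.single (next_var x) 1)
       (c * of_nat (Poly_Mapping.lookup t x)))"
  unfolding D_monomial_def
  by (rule sum.mono_neutral_left) (use assms in \<open>auto simp: in_keys_iff\<close>)

lemma minus_single_add_commute:
  fixes s t :: "'v \<Rightarrow>\<^sub>0 nat"
  assumes "Poly_Mapping.lookup s x \<noteq> 0"
  shows "s + t - Poly_Mapping.single x 1 = s - Poly_Mapping.single x 1 + t"
  by (rule poly_mapping_eqI) (use assms in \<open>auto simp: lookup_add lookup_minus lookup_single when_def\<close>)

lemma D_monomial_mult:
  "D_monomial (s + t) (a * b) =
     D_monomial s a * Poly_Mapping.single t b + Poly_Mapping.single s a * D_monomial t b"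
proof -
  let ?A = "Poly_Mapping.keys s \<union> Poly_Mapping.keys t"
  let ?T = "\<lambda>t x c. Poly_Mapping.single
    (t - Poly_Mapping.single x 1 + Poly_Mapping.single (next_var x) 1)
       (c * of_nat (Poly_Mapping.lookup t x) :: rat)"
  have 1: "?T (s + t) x (a * b) = ?T s x a * Poly_Mapping.single t b + Poly_Mapping.single s a * ?T t x b"
    for x
  proof -
    let ?e = "Poly_Mapping.single x (1::nat)" and ?e' = "Poly_Mapping.single (next_var x) (1::nat)"
    have s: "?T s x a * Poly_Mapping.single t b =
      Poly_Mapping.single (s + t - ?e + ?e') (a * b * of_nat (Poly_Mapping.lookup s x))"
    proof (cases "Poly_Mapping.lookup s x = 0")
      case False
      then show ?thesis
        using minus_single_add_commute[OF False, of t] by (simp add: mult_single algebra_simps)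
    qed simp
    have t: "Poly_Mapping.single s a * ?T t x b =
      Poly_Mapping.single (s + t - ?e + ?e') (a * b * of_nat (Poly_Mapping.lookup t x))"
    proof (cases "Poly_Mapping.lookup t x = 0")
      case False
      then show ?thesis
        using minus_single_add_commute[OF False, of s] by (simp add: mult_single algebra_simps)
    qed simp
    show ?thesis
      unfolding s t by (simp add: lookup_add distrib_left flip: single_add)
  qed
  have "Poly_Mapping.keys (s + t) \<subseteq> ?A" by (rule Poly_Mapping.keys_add)
  then have "D_monomial (s + t) (a * b) = (\<Sum>x\<in>?A. ?T (s + t) x (a * b))"
    by (intro D_monomial_superset) auto
  also have "\<dots> = (\<Sum>x\<in>?A. ?T s x a) * Poly_Mapping.single t b
      + Poly_Mapping.single s a * (\<Sum>x\<in>?A. ?T t x b)"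
    by (simp only: 1 sum.distrib sum_distrib_left sum_distrib_right)
  also have "(\<Sum>x\<in>?A. ?T s x a) = D_monomial s a"
    by (intro D_monomial_superset[symmetric]) auto
  also have "(\<Sum>x\<in>?A. ?T t x b) = D_monomial t b"
    by (intro D_monomial_superset[symmetric]) auto
  finally show ?thesis .
qed

lemma D_mult: "D (p * q) = D p * q + p * D q"
proof (induction p rule: poly_mapping_single_add_induct)
  case (single s a)
  show ?case
  proof (induction q rule: poly_mapping_single_add_induct)
    case (single t b)
    show ?case by (simp add: mult_single D_single D_monomial_mult)
  next
    case (add p q)
    then show ?case by (simp add: D_add algebra_simps)
  qed
next
  case (add p q)
  then show ?case by (simp add: D_add algebra_simps)
qed

lemma const_0 [simp]: "const 0 = 0"
  by (simp add: const_def)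

lemma const_1 [simp]: "const 1 = 1"
  by (simp add: const_def)

lemma const_add: "const (a + b) = const a + const b"
  by (simp add: const_def single_add)

lemma const_mult: "const (a * b) = const a * const b"
  by (simp add: const_def mult_single)

lemma eval_dpoly_conv_sum_terms: "eval_dpoly \<sigma> = sum_terms (eval_monomial \<sigma>)"
  by (rule ext) (simp add: eval_dpoly_def sum_terms_def)

lemma eval_dpoly_add: "eval_dpoly \<sigma> (p + q) = eval_dpoly \<sigma> p + eval_dpoly \<sigma> q"
  unfolding eval_dpoly_conv_sum_terms
  by (rule sum_terms_add) (simp_all add: eval_monomial_def const_add distrib_right)

lemma eval_dpoly_single: "eval_dpoly \<sigma> (Poly_Mapping.single t c) = eval_monomial \<sigma> t c"
  unfolding eval_dpoly_conv_sum_terms by (rule sum_terms_single) (simp add: eval_monomial_def)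

lemma eval_dpoly_const [simp]: "eval_dpoly \<sigma> (const c) = const c"
  by (simp add: const_def[of c] eval_dpoly_single eval_monomial_def)

lemma eval_dpoly_var [simp]: "eval_dpoly \<sigma> (var x) = \<sigma> x"
  by (simp add: var_def eval_dpoly_single eval_monomial_def)

lemma eval_monomial_mult:
  "eval_monomial \<sigma> (s + t) (a * b) = eval_monomial \<sigma> s a * eval_monomial \<sigma> t b"
proof -
  let ?A = "Poly_Mapping.keys s \<union> Poly_Mapping.keys t"
  have sup: "(\<Prod>x\<in>Poly_Mapping.keys r. \<sigma> x ^ Poly_Mapping.lookup r x) =
      (\<Prod>x\<in>?A. \<sigma> x ^ Poly_Mapping.lookup r x)" if "Poly_Mapping.keys r \<subseteq> ?A" for r
    by (rule prod.mono_neutral_left) (use that in \<open>auto simp: in_keys_iff\<close>)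
  have "(\<Prod>x\<in>Poly_Mapping.keys (s + t). \<sigma> x ^ Poly_Mapping.lookup (s + t) x) =
      (\<Prod>x\<in>Poly_Mapping.keys s. \<sigma> x ^ Poly_Mapping.lookup s x) *
      (\<Prod>x\<in>Poly_Mapping.keys t. \<sigma> x ^ Poly_Mapping.lookup t x)"
    unfolding sup[OF Poly_Mapping.keys_add] sup[OF Un_upper1] sup[OF Un_upper2]
    by (simp add: lookup_add power_add prod.distrib)
  then show ?thesis
    by (simp only: eval_monomial_def const_mult mult_ac)
qed

lemma eval_dpoly_mult: "eval_dpoly \<sigma> (p * q) = eval_dpoly \<sigma> p * eval_dpoly \<sigma> q"
proof (induction p rule: poly_mapping_single_add_induct)
  case (single s a)
  show ?case
  proof (induction q rule: poly_mapping_single_add_induct)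
    case (single t b)
    show ?case by (simp add: mult_single eval_dpoly_single eval_monomial_mult)
  next
    case (add p q)
    then show ?case by (simp add: eval_dpoly_add algebra_simps)
  qed
next
  case (add p q)
  then show ?case by (simp add: eval_dpoly_add algebra_simps)
qed

lemma subst_Y_D: "subst_Y q (D p) = D (subst_Y q p)"
proof -
  have vars: "subst_Y q (D (var x)) = D (subst_Y q (var x))" for x
    by (cases x) (simp_all add: subst_Y_def)
  have subst_add: "subst_Y q (a + b) = subst_Y q a + subst_Y q b" for a b
    by (simp add: subst_Y_def eval_dpoly_add)
  have mult: "subst_Y q (a * b) = subst_Y q a * subst_Y q b" for a b
    by (simp add: subst_Y_def eval_dpoly_mult)
  have const: "subst_Y q (const c) = const c" for c
    by (simp add: subst_Y_def)
  have prod_step: "subst_Y q (D (a * b)) = D (subst_Y q (a * b))"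
    if "subst_Y q (D a) = D (subst_Y q a)" "subst_Y q (D b) = D (subst_Y q b)" for a b
    using that by (simp add: D_mult subst_add mult)
  have mono: "subst_Y q (D (Poly_Mapping.single t 1)) = D (subst_Y q (Poly_Mapping.single t 1))" for t
  proof (induction t rule: poly_mapping_single_add_induct)
    case (single x e)
    have "Poly_Mapping.single (Poly_Mapping.single x e) 1 = var x ^ e"
    proof (induction e)
      case 0
      show ?case by simp
    next
      case (Suc e)
      have "Poly_Mapping.single (Poly_Mapping.single x (Suc e)) 1 =
          var x * Poly_Mapping.single (Poly_Mapping.single x e) 1"
        by (simp add: var_def mult_single flip: single_add)
      then show ?case using Suc by simp
    qed
    moreover have "subst_Y q (D (var x ^ e)) = D (subst_Y q (var x ^ e))"
    proof (induction e)
      case 0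
      show ?case using const[of 1] D_const[of 1] const[of 0] by simp
    next
      case (Suc e)
      then show ?case using prod_step[OF vars] by simp
    qed
    ultimately show ?case by simp
  next
    case (add s t)
    then show ?case
      using prod_step[of "Poly_Mapping.single s 1" "Poly_Mapping.single t 1"] by (simp add: mult_single)
  qed
  show ?thesis
  proof (induction p rule: poly_mapping_single_add_induct)
    case (single t c)
    have "Poly_Mapping.single t c = const c * Poly_Mapping.single t 1"
      by (simp add: const_def mult_single)
    then show ?case
      using prod_step[of "const c", OF _ mono] const[of c] const[of 0] by simp
  next
    case (add a b)
    then show ?case by (simp add: D_add subst_add)
  qed
qed

locale derivation =
  fixes \<delta> :: "'a::comm_ring_1 \<Rightarrow> 'a"
  assumes der_add: "\<delta> (a + b) = \<delta> a + \<delta> b"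
    and der_mult: "\<delta> (a * b) = \<delta> a * b + a * \<delta> b"
begin

lemma der_0 [simp]: "\<delta> 0 = 0"
  using der_add[of 0 0] by simp

lemma der_1 [simp]: "\<delta> 1 = 0"
  using der_mult[of 1 1] by simp

lemma coeff_d_times: "coeff (d_times \<delta> B) k = (case k of 0 \<Rightarrow> 0 | Suc j \<Rightarrow> coeff B j) + \<delta> (coeff B k)"
  by (simp add: d_times_def coeff_map_poly coeff_pCons)

lemma d_times_add: "d_times \<delta> (A + B) = d_times \<delta> A + d_times \<delta> B"
  by (rule poly_eqI) (simp add: coeff_d_times der_add split: nat.split)

lemma d_times_0 [simp]: "d_times \<delta> 0 = 0"
  by (simp add: d_times_def)

lemma d_times_smult: "d_times \<delta> (smult a B) = smult a (d_times \<delta> B) + smult (\<delta> a) B"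
  by (rule poly_eqI) (simp add: coeff_d_times der_mult algebra_simps split: nat.split)

lemma d_times_pow_add: "(d_times \<delta> ^^ i) (A + B) = (d_times \<delta> ^^ i) A + (d_times \<delta> ^^ i) B"
  by (induction i) (simp_all add: d_times_add)

lemma d_times_sum: "d_times \<delta> (\<Sum>i\<in>I. f i) = (\<Sum>i\<in>I. d_times \<delta> (f i))"
  by (induction I rule: infinite_finite_induct) (simp_all add: d_times_add)

lemma op_mult_eq:
  assumes "degree A \<le> N"
  shows "op_mult \<delta> A B = (\<Sum>i\<le>N. smult (coeff A i) ((d_times \<delta> ^^ i) B))"
  unfolding op_mult_def
  by (rule sum.mono_neutral_left) (use assms in \<open>auto simp: coeff_eq_0\<close>)

lemma op_mult_add_left: "op_mult \<delta> (A + B) C = op_mult \<delta> A C + op_mult \<delta> B C"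
proof -
  let ?N = "max (degree A) (degree B)"
  have "degree (A + B) \<le> ?N" by (rule degree_add_le_max)
  then show ?thesis
    by (subst (1 2 3) op_mult_eq[where N = ?N]) (simp_all add: smult_add_left sum.distrib)
qed

lemma op_mult_add_right: "op_mult \<delta> A (B + C) = op_mult \<delta> A B + op_mult \<delta> A C"
  by (simp add: op_mult_def d_times_pow_add smult_add_right sum.distrib)

lemma smult_sum_right: "smult a (\<Sum>i\<in>I. f i) = (\<Sum>i\<in>I. smult a (f i))"
  by (induction I rule: infinite_finite_induct) (simp_all add: smult_add_right)

lemma op_mult_smult_left: "op_mult \<delta> (smult a A) B = smult a (op_mult \<delta> A B)"
proof -
  have "degree (smult a A) \<le> degree A" by (rule degree_smult_le)
  then show ?thesis
    by (subst op_mult_eq[where N = "degree A"])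
      (simp_all add: op_mult_def smult_sum_right)
qed

lemma op_mult_0_left [simp]: "op_mult \<delta> 0 B = 0"
  by (simp add: op_mult_def)

lemma op_mult_const_left [simp]: "op_mult \<delta> [:a:] B = smult a B"
  by (simp add: op_mult_def)

lemma op_mult_1_left: "op_mult \<delta> 1 B = B"
  by (simp add: op_mult_def)

lemma d_times_pow_1: "(d_times \<delta> ^^ i) 1 = monom 1 i"
  by (induction i) (auto intro!: poly_eqI simp: coeff_d_times split: nat.split)

lemma op_mult_1_right: "op_mult \<delta> A 1 = A"
proof -
  have "op_mult \<delta> A 1 = (\<Sum>i\<le>degree A. monom (coeff A i) i)"
    by (simp add: op_mult_def d_times_pow_1 smult_monom)
  then show ?thesis by (simp add: poly_as_sum_of_monoms)
qed

lemma op_mult_d_left: "op_mult \<delta> [:0, 1:] B = d_times \<delta> B"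
  by (simp add: op_mult_def)

lemma op_mult_pCons_0_left: "op_mult \<delta> (pCons 0 A) B = op_mult \<delta> A (d_times \<delta> B)"
proof -
  have "op_mult \<delta> (pCons 0 A) B =
      (\<Sum>i\<le>Suc (degree A). smult (coeff (pCons 0 A) i) ((d_times \<delta> ^^ i) B))"
    by (rule op_mult_eq) (rule degree_pCons_le)
  also have "\<dots> = (\<Sum>i\<le>degree A. smult (coeff A i) ((d_times \<delta> ^^ Suc i) B))"
    by (subst sum.atMost_Suc_shift) simp
  finally show ?thesis by (simp add: op_mult_def funpow_swap1)
qed

lemma op_mult_d_times_left: "op_mult \<delta> (d_times \<delta> A) B = d_times \<delta> (op_mult \<delta> A B)"
proof -
  have deg: "degree (map_poly \<delta> A) \<le> degree A"
    by (rule degree_le) (simp add: coeff_map_poly coeff_eq_0)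
  have "d_times \<delta> (op_mult \<delta> A B) =
      (\<Sum>i\<le>degree A. smult (coeff A i) ((d_times \<delta> ^^ i) (d_times \<delta> B)))
      + (\<Sum>i\<le>degree A. smult (\<delta> (coeff A i)) ((d_times \<delta> ^^ i) B))"
    by (simp add: op_mult_def d_times_sum d_times_smult sum.distrib funpow_swap1)
  also have "\<dots> = op_mult \<delta> (pCons 0 A) B + op_mult \<delta> (map_poly \<delta> A) B"
    unfolding op_mult_pCons_0_left op_mult_eq[OF deg] by (simp add: op_mult_def coeff_map_poly)
  also have "\<dots> = op_mult \<delta> (d_times \<delta> A) B"
    by (simp add: d_times_def op_mult_add_left)
  finally show ?thesis ..
qed

lemma op_mult_assoc: "op_mult \<delta> (op_mult \<delta> A B) C = op_mult \<delta> A (op_mult \<delta> B C)"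
proof -
  have pow: "op_mult \<delta> ((d_times \<delta> ^^ i) B) C = (d_times \<delta> ^^ i) (op_mult \<delta> B C)" for i
    by (induction i) (simp_all add: op_mult_d_times_left)
  have sum: "op_mult \<delta> (\<Sum>i\<in>I. f i) C = (\<Sum>i\<in>I. op_mult \<delta> (f i) C)" for I and f :: "nat \<Rightarrow> _"
    by (induction I rule: infinite_finite_induct) (simp_all add: op_mult_add_left)
  show ?thesis
    by (simp add: op_mult_def[of _ A] sum op_mult_smult_left pow)
qed

lemma d_commutation: "op_mult \<delta> [:0, 1:] [:s:] = op_mult \<delta> [:s:] [:0, 1:] + [:\<delta> s:]"
  unfolding op_mult_d_left by (auto intro!: poly_eqI simp: coeff_d_times coeff_pCons split: nat.split)

end

interpretation D: derivation D
  by standard (simp_all add: D_add D_mult)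

end

theory Submission
  imports Defs
begin

text \<open>
  For existence, let \<open>Q = \<partial> + \<dots>\<close> be the \<open>n\<close>-th root of \<open>L\<close> among the pseudo-differential operators.
  Its coefficients are obtained recursively without integration, since they enter \<open>Q\<^sup>n\<close> linearly with
  factor \<open>n\<close>, and the \<open>k\<close>-th one has weight \<open>k\<close>. The power \<open>Q\<^sup>m\<close> commutes with \<open>L\<close>, so
  \<open>[L, P]\<close> has order at most \<open>n - 2\<close> for its differential part \<open>P\<close>; the coefficient of \<open>\<partial>\<^bsup>m-1\<^esup>\<close>
  in \<open>P\<close> vanishes because no nonzero polynomial has weight 1. For uniqueness, the equation with index
  \<open>i = l + 1\<close> determines \<open>n \<partial>(q\<^sub>l)\<close> from the preceding \<open>q\<close>'s, and \<open>\<partial>\<close> is injective on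
  polynomials of positive weight.
\<close>

section \<open>Pseudo-differential operators over a differential ring\<close>

context derivation
begin

lemma der_sum: "\<delta> (\<Sum>i\<in>I. f i) = (\<Sum>i\<in>I. \<delta> (f i))"
  by (induction I rule: infinite_finite_induct) (simp_all add: der_add)

text \<open>
  A sequence \<open>A\<close> together with an order \<open>N\<close> encodes the pseudo-differential operator
  \<open>\<Sum>\<^sub>k A k \<partial>\<^bsup>N-k\<^esup>\<close>. Left multiplication by \<open>\<partial>\<close> then raises the order by one and acts on sequences
  by \<open>shift\<close>, whatever \<open>N\<close> is; multiplication by \<open>\<partial>\<^bsup>-1\<^esup>\<close> is its inverse \<open>unshift\<close>.
\<close>

definition shift :: "(nat \<Rightarrow> 'a) \<Rightarrow> nat \<Rightarrow> 'a" where
  "shift A k = A k + (case k of 0 \<Rightarrow> 0 | Suc j \<Rightarrow> \<delta> (A j))"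

primrec unshift :: "(nat \<Rightarrow> 'a) \<Rightarrow> nat \<Rightarrow> 'a" where
  "unshift A 0 = A 0"
| "unshift A (Suc k) = A (Suc k) - \<delta> (unshift A k)"

lemma shift_unshift [simp]: "shift (unshift A) = A"
proof
  show "shift (unshift A) k = A k" for k
    by (cases k) (simp_all add: shift_def)
qed

lemma unshift_shift [simp]: "unshift (shift A) = A"
proof
  show "unshift (shift A) k = A k" for k
    by (induction k) (simp_all add: shift_def)
qed

text \<open>Negative exponents occur because a product with left order \<open>N\<close> involves the
  power \<open>N - i\<close> of \<partial> for every index \<open>i\<close>.\<close>

definition shift_pow :: "int \<Rightarrow> (nat \<Rightarrow> 'a) \<Rightarrow> nat \<Rightarrow> 'a" where
  "shift_pow I = (if I \<ge> 0 then shift ^^ nat I else unshift ^^ nat (- I))"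

lemma shift_pow_0 [simp]: "shift_pow 0 A = A"
  by (simp add: shift_pow_def)

lemma shift_pow_of_nat: "shift_pow (int i) = shift ^^ i"
  by (simp add: shift_pow_def)

lemma shift_pow_add_1: "shift_pow (I + 1) A = shift (shift_pow I A)"
proof (cases "I \<ge> 0")
  case True
  then have "nat (I + 1) = Suc (nat I)" by simp
  then show ?thesis using True by (simp add: shift_pow_def)
next
  case False
  then have "nat (- I) = Suc (nat (- (I + 1)))" by simp
  then have "shift_pow I A = unshift (shift_pow (I + 1) A)"
    using False by (cases "I + 1 = 0") (simp_all add: shift_pow_def)
  then show ?thesis by simp
qed

lemma shift_pow_at_0 [simp]: "shift_pow I A 0 = A 0"
proof (induction I rule: int_induct[where k = 0])
  case (step2 i)
  then show ?case using shift_pow_add_1[of "i - 1" A] by (simp add: shift_def)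
qed (simp_all add: shift_pow_add_1 shift_def)

lemma shift_pow_add_1_at_Suc: "shift_pow (I + 1) A (Suc k) = shift_pow I A (Suc k) + \<delta> (shift_pow I A k)"
  by (simp add: shift_pow_add_1 shift_def)

lemma shift_pow_diff_1_at_Suc:
  "shift_pow (I - 1) A (Suc k) = shift_pow I A (Suc k) - \<delta> (shift_pow (I - 1) A k)"
  using shift_pow_add_1_at_Suc[of "I - 1"] by simp

text \<open>Apart from \<open>A k\<close> itself, moving a power of \<partial> past the coefficients
  brings only derivatives of earlier entries to index \<open>k\<close>.\<close>

lemma shift_pow_perturb:
  assumes "\<And>j. j < k \<Longrightarrow> A j = B j"
  shows "shift_pow I A k = shift_pow I B k + (A k - B k)"
  using assms
proof (induction k arbitrary: I)
  case (Suc k)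
  have eq: "shift_pow J A k = shift_pow J B k" for J
    using Suc.IH[of J] Suc.prems by simp
  show ?case
    by (induction I rule: int_induct[where k = 0])
      (simp_all add: shift_pow_add_1_at_Suc shift_pow_diff_1_at_Suc eq)
qed simp

lemma shift_pow_cong:
  assumes "\<And>j. j \<le> k \<Longrightarrow> A j = B j"
  shows "shift_pow I A k = shift_pow I B k"
  using shift_pow_perturb[of k A B I] assms by simp

text \<open>This is the first correction term in \<open>\<partial>^I a = a \<partial>^I + I
  (\<delta> a) \<partial>^(I-1) + ...\<close>; it carries the derivative of an unknown into the
  commutator.\<close>

lemma shift_pow_perturb_Suc:
  assumes "\<And>j. j < k \<Longrightarrow> A j = B j"
  shows "shift_pow I A (Suc k) =
    shift_pow I B (Suc k) + (A (Suc k) - B (Suc k)) + of_int I * \<delta> (A k - B k)"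
proof -
  have eq: "shift_pow J A k = shift_pow J B k + (A k - B k)" for J
    using shift_pow_perturb[of k A B J] assms by simp
  have "\<delta> (shift_pow J A k) = \<delta> (shift_pow J B k) + \<delta> (A k - B k)" for J
    unfolding eq by (rule der_add)
  then show ?thesis
    by (induction I rule: int_induct[where k = 0])
      (simp_all add: shift_pow_add_1_at_Suc shift_pow_diff_1_at_Suc algebra_simps)
qed

lemma shift_pow_at_1: "shift_pow I A (Suc 0) = A (Suc 0) + of_int I * \<delta> (A 0)"
  by (induction I rule: int_induct[where k = 0])
    (simp_all add: shift_pow_add_1_at_Suc shift_pow_diff_1_at_Suc algebra_simps)

text \<open>Here \<open>N\<close> is the order of \<open>A\<close>; the coefficients of the product do not depend on the order of \<open>B\<close>.\<close>

definition psd_mult :: "int \<Rightarrow> (nat \<Rightarrow> 'a) \<Rightarrow> (nat \<Rightarrow> 'a) \<Rightarrow> nat \<Rightarrow> 'a" where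
  "psd_mult N A B k = (\<Sum>i\<le>k. A i * shift_pow (N - int i) B (k - i))"

text \<open>Associativity with left factor \<partial>, from which the general case is built; it
  amounts to the Leibniz rule.\<close>

lemma shift_psd_mult: "shift (psd_mult M B C) = psd_mult (M + 1) (shift B) C"
proof
  fix k
  show "shift (psd_mult M B C) k = psd_mult (M + 1) (shift B) C k"
  proof (cases k)
    case 0
    then show ?thesis by (simp add: shift_def psd_mult_def)
  next
    case (Suc l)
    let ?S = "\<lambda>i. shift_pow (M - int i) C"
    have "shift (psd_mult M B C) k = (\<Sum>i\<le>Suc l. B i * ?S i (Suc l - i))
        + (\<Sum>i\<le>l. B i * \<delta> (?S i (l - i))) + (\<Sum>i\<le>l. \<delta> (B i) * ?S i (l - i))"
      by (simp add: Suc shift_def psd_mult_def der_add der_sum der_mult sum.distrib algebra_simps)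
    \<comment> \<open>The terms in which \<delta> hits the right factor raise the power of
      \<partial> by one; those in which it hits \<open>B\<close> supply, after an index shift, the
      derivative part of \<open>shift B\<close>.\<close>
    also have "(\<Sum>i\<le>Suc l. B i * ?S i (Suc l - i)) + (\<Sum>i\<le>l. B i * \<delta> (?S i (l - i)))
        = (\<Sum>i\<le>l. B i * (?S i (Suc (l - i)) + \<delta> (?S i (l - i)))) + B (Suc l) * C 0"
      by (simp add: sum.distrib distrib_left Suc_diff_le)
    also have "\<dots> = (\<Sum>i\<le>Suc l. B i * shift_pow (M + 1 - int i) C (Suc l - i))"
    proof -
      have "shift_pow (M + 1 - int i) C (Suc (l - i)) = ?S i (Suc (l - i)) + \<delta> (?S i (l - i))" for i
        using shift_pow_add_1_at_Suc[of "M - int i" C "l - i"] by (simp add: algebra_simps)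
      then show ?thesis by (simp add: Suc_diff_le)
    qed
    also have "\<dots> + (\<Sum>i\<le>l. \<delta> (B i) * ?S i (l - i)) = psd_mult (M + 1) (shift B) C k"
      unfolding psd_mult_def Suc
      by (simp only: shift_def distrib_right sum.distrib)
        (simp add: sum.atMost_Suc_shift del: sum.atMost_Suc)
    finally show ?thesis .
  qed
qed

lemma shift_pow_psd_mult: "shift_pow I (psd_mult M B C) = psd_mult (M + I) (shift_pow I B) C"
proof (induction I rule: int_induct[where k = 0])
  case (step1 i)
  then show ?case by (simp add: shift_pow_add_1 shift_psd_mult add.assoc)
next
  case (step2 i)
  have s: "shift_pow i X = shift (shift_pow (i - 1) X)" for X
    using shift_pow_add_1[of "i - 1" X] by simp
  have "shift (shift_pow (i - 1) (psd_mult M B C)) = shift (psd_mult (M + (i - 1)) (shift_pow (i - 1) B) C)"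
    using step2 by (simp add: shift_psd_mult add.assoc flip: s)
  \<comment> \<open>The common factor \<partial> cancels, since \<open>shift\<close> is
    injective.\<close>
  then show ?case by (metis unshift_shift)
qed simp

text \<open>By \<open>shift_pow_psd_mult\<close>, powers of \<partial> are absorbed into the left
  factor of the inner product; both sides then become one double sum over
  \<open>i + j \<le> k\<close>.\<close>

lemma psd_mult_assoc: "psd_mult (N + M) (psd_mult N A B) C = psd_mult N A (psd_mult M B C)"
proof
  fix k
  let ?g = "\<lambda>i j. A i * shift_pow (N - int i) B j * shift_pow (N + M - int (i + j)) C (k - (i + j))"
  have "psd_mult N A (psd_mult M B C) k = (\<Sum>i\<le>k. \<Sum>j\<le>k - i. ?g i j)"
    by (simp add: psd_mult_def[of N A] shift_pow_psd_mult)
      (simp add: psd_mult_def sum_distrib_left algebra_simps)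
  also have "\<dots> = (\<Sum>(i, j)\<in>{(i, j). i + j \<le> k}. ?g i j)"
    by (subst sum.Sigma) (auto intro!: sum.cong)
  also have "\<dots> = (\<Sum>l\<le>k. \<Sum>i\<le>l. ?g i (l - i))"
    by (rule sum.triangle_reindex_eq)
  also have "\<dots> = psd_mult (N + M) (psd_mult N A B) C k"
    by (simp add: psd_mult_def sum_distrib_right)
  finally show "psd_mult (N + M) (psd_mult N A B) C k = psd_mult N A (psd_mult M B C) k" ..
qed

lemma psd_mult_at_0 [simp]: "psd_mult N A B 0 = A 0 * B 0"
  by (simp add: psd_mult_def)

text \<open>Only the summands \<open>i = 0\<close> and \<open>i = k\<close> see entries of index
  \<open>k\<close>, each paired with a leading coefficient.\<close>

lemma psd_mult_perturb:
  assumes "k > 0" "\<And>j. j < k \<Longrightarrow> A j = A' j" "\<And>j. j < k \<Longrightarrow> B j = B' j"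
  shows "psd_mult N A B k = psd_mult N A' B' k + (A k - A' k) * B' 0 + A' 0 * (B k - B' k)"
proof -
  obtain l where k: "k = Suc l" using assms(1) by (cases k) auto
  have B0: "B 0 = B' 0" "A 0 = A' 0" using assms by auto
  have "(\<Sum>i\<le>l. A i * shift_pow (N - int i) B (k - i)) =
    (\<Sum>i\<le>l. A' i * shift_pow (N - int i) B' (k - i) + (if i = 0 then A' 0 * (B k - B' k) else 0))"
  proof (rule sum.cong)
    fix i assume i: "i \<in> {..l}"
    then have A: "A i = A' i" using assms k by auto
    have "shift_pow (N - int i) B (k - i) = shift_pow (N - int i) B' (k - i) + (B (k - i) - B' (k - i))"
      by (rule shift_pow_perturb) (use assms in auto)
    moreover have "B (k - i) = B' (k - i)" if "i \<noteq> 0" using that assms by auto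
    ultimately show "A i * shift_pow (N - int i) B (k - i) =
      A' i * shift_pow (N - int i) B' (k - i) + (if i = 0 then A' 0 * (B k - B' k) else 0)"
      by (cases "i = 0") (simp_all add: A B0 distrib_left)
  qed simp
  then have "(\<Sum>i\<le>l. A i * shift_pow (N - int i) B (k - i)) =
    (\<Sum>i\<le>l. A' i * shift_pow (N - int i) B' (k - i)) + A' 0 * (B k - B' k)"
    by (simp add: sum.distrib)
  then show ?thesis by (simp add: psd_mult_def k B0 algebra_simps)
qed

definition psd_one :: "nat \<Rightarrow> 'a" where
  "psd_one k = (if k = 0 then 1 else 0)"

lemma psd_mult_one_left [simp]: "psd_mult 0 psd_one B = B"
  by (rule ext) (simp add: psd_mult_def psd_one_def if_distrib[of "\<lambda>x. x * _"] cong: if_cong)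

primrec psd_pow :: "(nat \<Rightarrow> 'a) \<Rightarrow> nat \<Rightarrow> nat \<Rightarrow> 'a" where
  "psd_pow Q 0 = psd_one"
| "psd_pow Q (Suc j) = psd_mult 1 Q (psd_pow Q j)"

text \<open>The right side is symmetric in \<open>i\<close> and \<open>j\<close>, so powers of a
  common \<open>Q\<close> commute; this yields the operator commuting with \<open>L\<close>.\<close>

lemma psd_pow_add: "psd_mult (int i) (psd_pow Q i) (psd_pow Q j) = psd_pow Q (i + j)"
proof (induction i)
  case (Suc i)
  then show ?case using psd_mult_assoc[of 1 "int i" Q "psd_pow Q i" "psd_pow Q j"] by simp
qed simp

lemma psd_pow_at_0: "Q 0 = 1 \<Longrightarrow> psd_pow Q j 0 = 1"
  by (induction j) (simp_all add: psd_one_def)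

text \<open>Each of the \<open>j\<close> factors contributes the change once, because all leading
  coefficients are 1.\<close>

lemma psd_pow_perturb:
  assumes "k > 0" "\<And>j. j < k \<Longrightarrow> Q j = Q' j" "Q' 0 = 1"
  shows "psd_pow Q j k = psd_pow Q' j k + of_nat j * (Q k - Q' k)"
  using assms(1,2)
proof (induction j arbitrary: k)
  case (Suc j)
  have "psd_pow Q j i = psd_pow Q' j i" if "i < k" for i
  proof (cases "i = 0")
    case True
    then show ?thesis using Suc.prems assms(3) by (simp add: psd_pow_at_0)
  next
    case False
    then show ?thesis using Suc.IH[of i] Suc.prems that by simp
  qed
  then show ?case
    using psd_mult_perturb[of k Q Q' "psd_pow Q j" "psd_pow Q' j" 1] Suc
    by (simp add: psd_pow_at_0 assms(3) algebra_simps)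
qed simp

text \<open>The changes at \<open>Suc k\<close> cancel between the two products. The change at
  \<open>k\<close> survives only as its derivative, through the leading power of \<partial> in
  \<open>A\<close>; undifferentiated it meets \<open>A (Suc 0) = 0\<close>. Existence and uniqueness
  both rest on this.\<close>

lemma psd_commutator_perturb:
  assumes "k > 0" "\<And>j. j < k \<Longrightarrow> B j = B' j" "A 0 = 1" "A (Suc 0) = 0"
  shows "psd_mult N A B (Suc k) - psd_mult M B A (Suc k) =
    psd_mult N A B' (Suc k) - psd_mult M B' A (Suc k) + of_int N * \<delta> (B k - B' k)"
proof -
  let ?e = "B (Suc k) - B' (Suc k)" and ?d = "of_int N * \<delta> (B k - B' k)"
  have "psd_mult N A B (Suc k) =
    (\<Sum>i\<le>Suc k. A i * shift_pow (N - int i) B' (Suc k - i) + (if i = 0 then ?e + ?d else 0))"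
    unfolding psd_mult_def
  proof (rule sum.cong)
    fix i assume i: "i \<in> {..Suc k}"
    consider "i = 0" | "i = 1" | "i \<ge> 2" by linarith
    then show "A i * shift_pow (N - int i) B (Suc k - i) =
      A i * shift_pow (N - int i) B' (Suc k - i) + (if i = 0 then ?e + ?d else 0)"
    proof cases
      case 1
      then show ?thesis using shift_pow_perturb_Suc[of k B B' N] assms by (simp add: algebra_simps)
    next
      case 3
      then have "shift_pow (N - int i) B (Suc k - i) = shift_pow (N - int i) B' (Suc k - i)"
        by (intro shift_pow_cong) (use assms in auto)
      then show ?thesis using 3 by simp
    qed (simp add: assms)
  qed simp
  then have 1: "psd_mult N A B (Suc k) = psd_mult N A B' (Suc k) + ?e + ?d"
    by (simp add: psd_mult_def sum.distrib algebra_simps del: sum.atMost_Suc)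
  have "psd_mult M B A (Suc k) =
    (\<Sum>i\<le>Suc k. B' i * shift_pow (M - int i) A (Suc k - i) + (if i = Suc k then ?e else 0))"
    unfolding psd_mult_def
  proof (rule sum.cong)
    fix i assume i: "i \<in> {..Suc k}"
    \<comment> \<open>At \<open>i = k\<close> the right factor is \<open>A (Suc 0)\<close> plus a
      multiple of \<delta> 1, hence zero.\<close>
    then consider "i = Suc k" | "i = k" | "i < k" by fastforce
    then show "B i * shift_pow (M - int i) A (Suc k - i) =
      B' i * shift_pow (M - int i) A (Suc k - i) + (if i = Suc k then ?e else 0)"
      by cases (simp_all add: assms shift_pow_at_1 Suc_diff_le)
  qed simp
  then have 2: "psd_mult M B A (Suc k) = psd_mult M B' A (Suc k) + ?e"
    by (simp add: psd_mult_def sum.distrib algebra_simps)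
  show ?thesis using 1 2 by simp
qed

section \<open>Differential operators among the pseudo-differential ones\<close>

definition psd_of_poly :: "nat \<Rightarrow> 'a poly \<Rightarrow> nat \<Rightarrow> 'a" where
  "psd_of_poly N A k = (if k \<le> N then coeff A (N - k) else 0)"

lemma psd_of_poly_d_times:
  assumes "degree A \<le> N"
  shows "psd_of_poly (Suc N) (d_times \<delta> A) = shift (psd_of_poly N A)"
proof
  show "psd_of_poly (Suc N) (d_times \<delta> A) k = shift (psd_of_poly N A) k" for k
    using assms
    by (cases k) (auto simp: psd_of_poly_def shift_def coeff_d_times coeff_eq_0 Suc_diff_le
        le_Suc_eq diff_Suc split: nat.split)
qed

lemma degree_d_times: "degree A \<le> N \<Longrightarrow> degree (d_times \<delta> A) \<le> Suc N"
  by (rule degree_le) (auto simp: coeff_d_times coeff_eq_0 split: nat.split)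

lemma degree_d_times_pow: "degree A \<le> N \<Longrightarrow> degree ((d_times \<delta> ^^ i) A) \<le> N + i"
  by (induction i) (auto intro: degree_d_times)

lemma psd_of_poly_d_times_pow:
  assumes "degree A \<le> N"
  shows "psd_of_poly (N + i) ((d_times \<delta> ^^ i) A) = shift_pow (int i) (psd_of_poly N A)"
  by (induction i)
    (simp_all add: shift_pow_of_nat psd_of_poly_d_times degree_d_times_pow assms del: of_nat_Suc)

text \<open>Both products expand \<open>A\<close> into coefficients times powers of \<partial>,
  counted from the bottom in \<open>op_mult\<close> and from the top in
  \<open>psd_mult\<close>.\<close>

lemma coeff_op_mult:
  assumes "degree A \<le> N" "degree B \<le> M" "k \<le> N + M"
  shows "coeff (op_mult \<delta> A B) (N + M - k) =
    psd_mult (int N) (psd_of_poly N A) (psd_of_poly M B) k"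
proof -
  let ?f = "\<lambda>i. psd_of_poly N A i * shift_pow (int N - int i) (psd_of_poly M B) (k - i)"
  have "coeff (op_mult \<delta> A B) (N + M - k) =
    (\<Sum>i\<le>N. coeff A i * coeff ((d_times \<delta> ^^ i) B) (N + M - k))"
    by (simp add: op_mult_eq[OF assms(1)] coeff_sum)
  also have "\<dots> = (\<Sum>i\<le>N. coeff A (N - i) * coeff ((d_times \<delta> ^^ (N - i)) B) (N + M - k))"
    by (subst sum.nat_diff_reindex[symmetric, of _ "Suc N", simplified lessThan_Suc_atMost]) simp
  also have "\<dots> = (\<Sum>i\<le>N. if i \<le> k then ?f i else 0)"
  proof (rule sum.cong)
    fix i assume "i \<in> {..N}"
    then have i: "i \<le> N" by simp
    show "coeff A (N - i) * coeff ((d_times \<delta> ^^ (N - i)) B) (N + M - k) = (if i \<le> k then ?f i else 0)"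
    proof (cases "i \<le> k")
      case True
      have "shift_pow (int N - int i) (psd_of_poly M B) (k - i) =
        psd_of_poly (M + (N - i)) ((d_times \<delta> ^^ (N - i)) B) (k - i)"
        using psd_of_poly_d_times_pow[OF assms(2), of "N - i"] i by (simp add: of_nat_diff)
      moreover have "M + (N - i) - (k - i) = N + M - k" using True i by simp
      ultimately show ?thesis using True i assms(3) by (auto simp: psd_of_poly_def)
    next
      case False
      have "degree ((d_times \<delta> ^^ (N - i)) B) \<le> M + (N - i)"
        by (rule degree_d_times_pow) (rule assms)
      also have "\<dots> < N + M - k" using False i by simp
      finally show ?thesis using False by (simp add: coeff_eq_0)
    qed
  qed simp
  also have "\<dots> = (\<Sum>i\<in>{..N} \<inter> {..k}. ?f i)"
    by (subst sum.inter_restrict) simp_all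
  \<comment> \<open>Entries beyond index \<open>N\<close> default to zero, so negative powers of
    \<partial> contribute nothing.\<close>
  also have "\<dots> = (\<Sum>i\<le>k. ?f i)"
    by (rule sum.mono_neutral_left) (auto simp: psd_of_poly_def)
  finally show ?thesis by (simp add: psd_mult_def)
qed

end

section \<open>Gradings and the extraction of roots\<close>

locale graded_derivation = derivation +
  fixes G :: "nat \<Rightarrow> 'a set"
  assumes zero_in [simp]: "0 \<in> G k"
    and one_in: "1 \<in> G 0"
    and diff_in: "a \<in> G k \<Longrightarrow> b \<in> G k \<Longrightarrow> a - b \<in> G k"
    and mult_in: "a \<in> G i \<Longrightarrow> b \<in> G j \<Longrightarrow> a * b \<in> G (i + j)"
    and der_in: "a \<in> G k \<Longrightarrow> \<delta> a \<in> G (Suc k)"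
begin

lemma add_in: "a \<in> G k \<Longrightarrow> b \<in> G k \<Longrightarrow> a + b \<in> G k"
  using diff_in[of a k "0 - b"] diff_in[of 0 k b] by simp

lemma sum_in: "(\<And>i. i \<in> I \<Longrightarrow> f i \<in> G k) \<Longrightarrow> (\<Sum>i\<in>I. f i) \<in> G k"
  by (induction I rule: infinite_finite_induct) (simp_all add: add_in)

text \<open>With \<partial> given weight 1, this makes the operator of order \<open>N\<close>
  encoded by \<open>A\<close> homogeneous of weight \<open>N\<close>.\<close>

definition graded_seq :: "(nat \<Rightarrow> 'a) \<Rightarrow> bool" where
  "graded_seq A \<longleftrightarrow> (\<forall>k. A k \<in> G k)"

lemma graded_seq_shift_pow:
  assumes "graded_seq A"
  shows "graded_seq (shift_pow I A)"
proof -
  have "shift_pow I A k \<in> G k" for k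
  proof (induction k arbitrary: I)
    case (Suc k)
    show ?case
      by (induction I rule: int_induct[where k = 0])
        (use assms Suc in \<open>auto simp: graded_seq_def shift_pow_add_1_at_Suc shift_pow_diff_1_at_Suc
          intro: add_in diff_in der_in\<close>)
  qed (use assms in \<open>simp add: graded_seq_def\<close>)
  then show ?thesis by (simp add: graded_seq_def)
qed

lemma graded_seq_psd_mult:
  assumes "graded_seq A" "graded_seq B"
  shows "graded_seq (psd_mult N A B)"
  unfolding graded_seq_def psd_mult_def
proof (intro allI sum_in)
  fix k i :: nat assume "i \<in> {..k}"
  then show "A i * shift_pow (N - int i) B (k - i) \<in> G k"
    using mult_in[of "A i" i "shift_pow (N - int i) B (k - i)" "k - i"]
      graded_seq_shift_pow[OF assms(2)] assms(1) by (auto simp: graded_seq_def)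
qed

lemma graded_seq_psd_one: "graded_seq psd_one"
  by (simp add: graded_seq_def psd_one_def one_in)

lemma graded_seq_psd_pow: "graded_seq Q \<Longrightarrow> graded_seq (psd_pow Q j)"
  by (induction j) (simp_all add: graded_seq_psd_one graded_seq_psd_mult)

text \<open>By \<open>psd_pow_perturb\<close>, adding \<open>c\<close> times the defect at index
  \<open>k\<close> to \<open>Q k\<close> removes that defect; \<open>c \<in> G 0\<close> keeps the
  correction in weight \<open>k\<close>.\<close>

lemma psd_root_exists:
  assumes A: "graded_seq A" "A 0 = 1" and c: "of_nat n * c = 1" "c \<in> G 0"
  shows "\<exists>Q. graded_seq Q \<and> Q 0 = 1 \<and> psd_pow Q n = A"
proof -
  define step where "step k Q = Q(k := Q k + c * (A k - psd_pow Q n k))" for k Q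
  \<comment> \<open>The power of stage \<open>k\<close> is correct up to index \<open>k\<close>; the
    start \<open>psd_one\<close>, read at order 1, is \<partial> itself.\<close>
  define f where "f = rec_nat psd_one (\<lambda>k. step (Suc k))"
  have f0: "f 0 = psd_one" and fSuc: "f (Suc k) = step (Suc k) (f k)" for k
    by (simp_all add: f_def)
  have graded: "graded_seq (f k)" for k
  proof (induction k)
    case (Suc k)
    have "c * (A (Suc k) - psd_pow (f k) n (Suc k)) \<in> G (0 + Suc k)"
      using A Suc graded_seq_psd_pow[OF Suc, of n]
      by (intro mult_in c(2) diff_in) (auto simp: graded_seq_def)
    then show ?case using Suc by (auto simp: fSuc step_def graded_seq_def add_in)
  qed (simp add: f0 graded_seq_psd_one)
  \<comment> \<open>Entry \<open>k\<close> is final from stage \<open>k\<close> on, so the diagonal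
    is the limit.\<close>
  have stable: "f (k + d) k = f k k" for k d
    by (induction d) (simp_all add: fSuc step_def)
  have f_at_0: "f k 0 = 1" for k
    using stable[of 0 k] by (simp add: f0 psd_one_def)
  define Q where "Q k = f k k" for k
  have Q_eq: "f k j = Q j" if "j \<le> k" for j k
    using stable[of j "k - j"] that by (simp add: Q_def)
  have "psd_pow Q n k = A k" for k
  proof (cases k)
    case 0
    then show ?thesis using A by (simp add: psd_pow_at_0 Q_def f0 psd_one_def)
  next
    case (Suc l)
    have "psd_pow Q n k = psd_pow (f l) n k + of_nat n * (Q k - f l k)"
      by (rule psd_pow_perturb) (use Suc in \<open>auto simp: Q_eq f_at_0\<close>)
    also have "Q k - f l k = c * (A k - psd_pow (f l) n k)"
      by (simp add: Q_def Suc fSuc step_def)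
    also have "of_nat n * \<dots> = A k - psd_pow (f l) n k"
      by (simp add: c(1) flip: mult.assoc)
    finally show ?thesis by simp
  qed
  moreover have "graded_seq Q" "Q 0 = 1"
    using graded by (auto simp: graded_seq_def Q_def f_at_0)
  ultimately show ?thesis by blast
qed

end

section \<open>The weight grading on differential polynomials\<close>

lemma monomial_weight_superset:
  assumes "finite A" "Poly_Mapping.keys t \<subseteq> A"
  shows "monomial_weight t = (\<Sum>x\<in>A. Poly_Mapping.lookup t x * var_weight x)"
  unfolding monomial_weight_def
  by (rule sum.mono_neutral_left) (use assms in \<open>auto simp: in_keys_iff\<close>)

lemma monomial_weight_add: "monomial_weight (s + t) = monomial_weight s + monomial_weight t"
proof -
  let ?A = "Poly_Mapping.keys s \<union> Poly_Mapping.keys t"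
  have "Poly_Mapping.keys (s + t) \<subseteq> ?A" by (rule Poly_Mapping.keys_add)
  then show ?thesis
    by (subst (1 2 3) monomial_weight_superset[of ?A])
      (auto simp: lookup_add distrib_right sum.distrib)
qed

lemma monomial_weight_single: "monomial_weight (Poly_Mapping.single x e) = e * var_weight x"
  by (subst monomial_weight_superset[of "{x}"]) auto

lemma var_weight_next_var [simp]: "var_weight (next_var x) = Suc (var_weight x)"
  by (cases x) simp_all

lemma minus_single_add_single:
  fixes t :: "'v \<Rightarrow>\<^sub>0 nat"
  assumes "x \<in> Poly_Mapping.keys t"
  shows "t - Poly_Mapping.single x 1 + Poly_Mapping.single x 1 = t"
  by (rule poly_mapping_eqI)
    (use assms in \<open>auto simp: lookup_add lookup_minus lookup_single when_def in_keys_iff\<close>)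

lemma in_keys_D:
  assumes "t \<in> Poly_Mapping.keys (D p)"
  obtains s x where "s \<in> Poly_Mapping.keys p" "x \<in> Poly_Mapping.keys s"
    "t = s - Poly_Mapping.single x 1 + Poly_Mapping.single (next_var x) 1"
proof -
  have "t \<in> (\<Union>s\<in>Poly_Mapping.keys p. Poly_Mapping.keys (D_monomial s (Poly_Mapping.lookup p s)))"
    using subsetD[OF keys_sum assms[unfolded D_def]] .
  then obtain s where s: "s \<in> Poly_Mapping.keys p"
    "t \<in> Poly_Mapping.keys (D_monomial s (Poly_Mapping.lookup p s))"
    by blast
  obtain x where "x \<in> Poly_Mapping.keys s" "t \<in> Poly_Mapping.keys
    (Poly_Mapping.single (s - Poly_Mapping.single x 1 + Poly_Mapping.single (next_var x) 1)
       (Poly_Mapping.lookup p s * of_nat (Poly_Mapping.lookup s x)))"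
    using subsetD[OF keys_sum s(2)[unfolded D_monomial_def]] by blast
  then show ?thesis using that s(1) by (auto split: if_splits)
qed

definition graded_part :: "nat \<Rightarrow> nat \<Rightarrow> dpoly set" where
  "graded_part n w = {p \<in> dpolys_U n. homogeneous_of_weight w p}"

lemma in_graded_part_iff: "p \<in> graded_part n w \<longleftrightarrow>
  (\<forall>t\<in>Poly_Mapping.keys p. Poly_Mapping.keys t \<subseteq> {U l k |l k. 2 \<le> l \<and> l \<le> n} \<and> monomial_weight t = w)"
  by (auto simp: graded_part_def dpolys_U_def homogeneous_of_weight_def)

lemma const_in_graded_part: "const c \<in> graded_part n 0"
  by (auto simp: in_graded_part_iff const_def monomial_weight_def)

lemma var_in_graded_part: "2 \<le> l \<Longrightarrow> l \<le> n \<Longrightarrow> var (U l 0) \<in> graded_part n l"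
  by (auto simp: in_graded_part_iff var_def monomial_weight_single)

lemma D_in_graded_part:
  assumes "p \<in> graded_part n w"
  shows "D p \<in> graded_part n (Suc w)"
  unfolding in_graded_part_iff
proof
  fix t assume "t \<in> Poly_Mapping.keys (D p)"
  then obtain s x where sx: "s \<in> Poly_Mapping.keys p" "x \<in> Poly_Mapping.keys s"
    and t: "t = s - Poly_Mapping.single x 1 + Poly_Mapping.single (next_var x) 1"
    by (rule in_keys_D)
  let ?V = "{U l k |l k. 2 \<le> l \<and> l \<le> n}"
  have s: "Poly_Mapping.keys s \<subseteq> ?V" "monomial_weight s = w"
    using assms sx(1) by (auto simp: in_graded_part_iff)
  have "Poly_Mapping.keys t \<subseteq> Poly_Mapping.keys s \<union> {next_var x}"
    by (auto simp: t in_keys_iff lookup_add lookup_minus lookup_single when_def split: if_splits)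
  moreover have "next_var x \<in> ?V" using s(1) sx(2) by auto
  ultimately have "Poly_Mapping.keys t \<subseteq> ?V" using s(1) by blast
  moreover have "monomial_weight t = Suc w"
  proof -
    let ?r = "s - Poly_Mapping.single x 1"
    have "monomial_weight (?r + Poly_Mapping.single x 1) = w"
      by (simp only: minus_single_add_single[OF sx(2)] s(2))
    then show ?thesis by (simp add: t monomial_weight_add monomial_weight_single)
  qed
  ultimately show "Poly_Mapping.keys t \<subseteq> ?V \<and> monomial_weight t = Suc w" ..
qed

lemma mult_in_graded_part:
  assumes "p \<in> graded_part n v" "q \<in> graded_part n w"
  shows "p * q \<in> graded_part n (v + w)"
  unfolding in_graded_part_iff
proof
  fix t assume "t \<in> Poly_Mapping.keys (p * q)"
  then obtain r s where "t = r + s" "r \<in> Poly_Mapping.keys p" "s \<in> Poly_Mapping.keys q"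
    using keys_mult[of p q] by blast
  then show "Poly_Mapping.keys t \<subseteq> {U l k |l k. 2 \<le> l \<and> l \<le> n} \<and> monomial_weight t = v + w"
    using assms Poly_Mapping.keys_add[of r s] unfolding in_graded_part_iff
    by (auto simp: monomial_weight_add dest!: subsetD)
qed

interpretation D: graded_derivation D "graded_part n" for n
proof
  show "a - b \<in> graded_part n k" if "a \<in> graded_part n k" "b \<in> graded_part n k" for a b k
    using that Poly_Mapping.keys_diff[of a b] unfolding in_graded_part_iff by blast
qed (use const_in_graded_part[of 1 n] in
  \<open>auto simp: in_graded_part_iff[of 0] D_in_graded_part mult_in_graded_part\<close>)

text \<open>All variables involved have weight at least 2, because their indices start at 2.\<close>

lemma graded_part_1: "graded_part n 1 = {0}"
proof -
  have "p = 0" if p: "p \<in> graded_part n 1" for p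
  proof (rule ccontr)
    assume "p \<noteq> 0"
    then obtain t where t: "t \<in> Poly_Mapping.keys p" by (metis ex_in_conv keys_eq_empty)
    then have V: "Poly_Mapping.keys t \<subseteq> {U l k |l k. 2 \<le> l \<and> l \<le> n}" and w: "monomial_weight t = 1"
      using p unfolding in_graded_part_iff by blast+
    have "Poly_Mapping.keys t \<noteq> {}"
      using w by (intro notI) (simp add: monomial_weight_def)
    then obtain x where x: "x \<in> Poly_Mapping.keys t" by blast
    have "Poly_Mapping.lookup t x * var_weight x \<le> 1"
      unfolding w[symmetric] monomial_weight_def by (rule member_le_sum) (use x in auto)
    moreover have "Poly_Mapping.lookup t x \<ge> 1" using x by (simp add: in_keys_iff Suc_le_eq)
    moreover have "var_weight x \<ge> 2" using V x by auto
    ultimately show False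
      using mult_le_mono[of 1 "Poly_Mapping.lookup t x" 2 "var_weight x"] by simp
  qed
  then show ?thesis by auto
qed

section \<open>The kernel of the derivation\<close>

fun var_order :: "dvar \<Rightarrow> nat" where
  "var_order (U l k) = k"
| "var_order (Y l k) = k"

lemma var_order_next_var [simp]: "var_order (next_var x) = Suc (var_order x)"
  by (cases x) simp_all

lemma inj_next_var: "next_var x = next_var y \<Longrightarrow> x = y"
  by (cases x; cases y) auto

text \<open>
  If \<open>x\<close> has maximal order among the variables of \<open>p\<close> and occurs in the monomial \<open>t\<close> of \<open>p\<close>, then
  replacing a factor \<open>x\<close> of \<open>t\<close> by its derivative gives a monomial that arises in \<open>D p\<close> in no
  other way.
\<close>

lemma D_eq_0_imp_constant:
  assumes "D p = 0"
  shows "Poly_Mapping.keys p \<subseteq> {0}"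
proof (rule ccontr)
  define V where "V = (\<Union>t\<in>Poly_Mapping.keys p. Poly_Mapping.keys t)"
  have "finite V" by (simp add: V_def)
  assume "\<not> Poly_Mapping.keys p \<subseteq> {0}"
  then have "V \<noteq> {}" by (auto simp: V_def)
  then obtain x where "x \<in> V" and max: "\<And>y. y \<in> V \<Longrightarrow> var_order y \<le> var_order x"
    using obtains_MAX[OF \<open>finite V\<close>, of var_order] by (metis Max_ge \<open>finite V\<close> finite_imageI image_eqI)
  then obtain t where t: "t \<in> Poly_Mapping.keys p" "x \<in> Poly_Mapping.keys t" by (auto simp: V_def)
  define r where "r s y = s - Poly_Mapping.single y 1 + Poly_Mapping.single (next_var y) (1 :: nat)"
    for s :: monomial and y
  have unique: "y = x \<and> s = t"
    if "s \<in> Poly_Mapping.keys p" "y \<in> Poly_Mapping.keys s" "r s y = r t x" for s y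
  proof -
    \<comment> \<open>The order of \<open>next_var x\<close> exceeds the maximum, so its occurrence
      in \<open>r s y\<close> can only come from the replacement.\<close>
    have "next_var x \<notin> Poly_Mapping.keys s"
      using max[of "next_var x"] that(1) by (auto simp: V_def)
    then have "Poly_Mapping.lookup s (next_var x) = 0" by (simp add: in_keys_iff)
    moreover have "Poly_Mapping.lookup (r s y) (next_var x) \<noteq> 0"
      unfolding that(3) by (simp add: r_def lookup_add)
    ultimately have "next_var y = next_var x"
      by (auto simp: r_def lookup_add lookup_minus lookup_single when_def split: if_splits)
    then have y: "y = x" by (rule inj_next_var)
    then have "s - Poly_Mapping.single x 1 = t - Poly_Mapping.single x 1"
      using that(3) by (simp add: r_def)
    then have "s = t"
      using minus_single_add_single that(2) t(2) y by metis
    with y show ?thesis ..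
  qed
  have "Poly_Mapping.lookup (D p) (r t x) = (\<Sum>s\<in>Poly_Mapping.keys p. \<Sum>y\<in>Poly_Mapping.keys s.
      Poly_Mapping.lookup p s * of_nat (Poly_Mapping.lookup s y) when r s y = r t x)"
    by (simp add: D_def D_monomial_def lookup_sum lookup_single r_def)
  also have "\<dots> = (\<Sum>s\<in>Poly_Mapping.keys p. \<Sum>y\<in>Poly_Mapping.keys s. if s = t then
      (if y = x then Poly_Mapping.lookup p t * of_nat (Poly_Mapping.lookup t x) else 0) else 0)"
    by (intro sum.cong refl) (use unique in \<open>auto simp: when_def\<close>)
  also have "\<dots> = (\<Sum>s\<in>Poly_Mapping.keys p. if s = t then
      Poly_Mapping.lookup p t * of_nat (Poly_Mapping.lookup t x) else 0)"
    by (intro sum.cong refl) (use t in auto)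
  also have "\<dots> = Poly_Mapping.lookup p t * of_nat (Poly_Mapping.lookup t x)"
    using t by simp
  \<comment> \<open>The positive exponent stays nonzero in characteristic 0.\<close>
  also have "\<dots> \<noteq> 0" using t by (simp add: in_keys_iff)
  finally show False using assms by simp
qed

lemma D_eq_0_homogeneous:
  assumes "D p = 0" "homogeneous_of_weight w p" "w > 0"
  shows "p = 0"
proof -
  have "0 \<notin> Poly_Mapping.keys p"
    using assms(2,3) by (auto simp: homogeneous_of_weight_def monomial_weight_def)
  then have "Poly_Mapping.keys p = {}"
    using D_eq_0_imp_constant[OF assms(1)] by blast
  then show ?thesis by simp
qed

section \<open>Substitution into the commutator coefficients\<close>

lemma map_poly_op_mult:
  fixes \<delta> :: "'a::comm_ring_1 \<Rightarrow> 'a" and \<delta>' :: "'b::comm_ring_1 \<Rightarrow> 'b"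
  assumes "derivation \<delta>" "derivation \<delta>'"
    and add: "\<And>a b. h (a + b) = h a + h b" and mult: "\<And>a b. h (a * b) = h a * h b"
    and der: "\<And>a. h (\<delta> a) = \<delta>' (h a)"
  shows "map_poly h (op_mult \<delta> A B) = op_mult \<delta>' (map_poly h A) (map_poly h B)"
proof -
  interpret \<delta>: derivation \<delta> by fact
  interpret \<delta>': derivation \<delta>' by fact
  have h0 [simp]: "h 0 = 0" using add[of 0 0] by simp
  have hsum: "h (\<Sum>i\<in>I. f i) = (\<Sum>i\<in>I. h (f i))" for I and f :: "nat \<Rightarrow> 'a"
    by (induction I rule: infinite_finite_induct) (simp_all add: add)
  have "map_poly h (d_times \<delta> C) = d_times \<delta>' (map_poly h C)" for C
    by (rule poly_eqI)
      (simp add: coeff_map_poly \<delta>.coeff_d_times \<delta>'.coeff_d_times add der split: nat.split)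
  then have pow: "map_poly h ((d_times \<delta> ^^ i) B) = (d_times \<delta>' ^^ i) (map_poly h B)" for i
    by (induction i) simp_all
  have coeff: "h (coeff C k) = coeff (map_poly h C) k" for C k
    by (simp add: coeff_map_poly)
  \<comment> \<open>\<open>h\<close> may annihilate the leading coefficient, so only a degree bound
    survives.\<close>
  have deg: "degree (map_poly h A) \<le> degree A"
    by (rule degree_le) (simp add: coeff_map_poly coeff_eq_0)
  show ?thesis
    unfolding \<delta>'.op_mult_eq[OF deg] op_mult_def[of \<delta>]
    by (intro poly_eqI) (simp add: coeff_map_poly coeff_sum hsum mult pow[symmetric])
qed

text \<open>The common shape of \<open>L_op n\<close>, \<open>P_op m\<close> and
  \<open>P_op m\<close> after substitution.\<close>

definition monic_op :: "nat \<Rightarrow> (nat \<Rightarrow> dpoly) \<Rightarrow> dpoly poly" where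
  "monic_op N f = monom 1 N + (\<Sum>l\<in>{2..N}. monom (f l) (N - l))"

lemma psd_of_poly_monic_op: "D.psd_of_poly N (monic_op N f) k =
  (if k = 0 then 1 else if k \<in> {2..N} then f k else 0)"
proof (cases "k \<le> N")
  case True
  have "coeff (monic_op N f) (N - k) =
    (if k = 0 then 1 else 0) + (\<Sum>l\<in>{2..N}. if l = k then f l else 0)"
    unfolding monic_op_def coeff_add coeff_sum
    by (intro arg_cong2[where f = "(+)"] sum.cong) (use True in \<open>auto simp: coeff_monom\<close>)
  then show ?thesis using True by (auto simp: D.psd_of_poly_def)
qed (simp add: D.psd_of_poly_def)

lemma degree_monic_op: "degree (monic_op N f) \<le> N"
  unfolding monic_op_def
  by (intro degree_add_le degree_sum_le)
    (auto simp: degree_monom_eq intro: order.trans[OF degree_monom_le])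

text \<open>Substitution is a homomorphism of differential rings and so passes through the
  commutator. The bound on \<open>i\<close> keeps the subtraction \<open>n + m - i\<close>
  exact.\<close>

lemma subst_Y_E_coeff:
  assumes "i \<le> n + m"
  shows "subst_Y q (E_coeff n m (n + m - i)) =
    D.psd_mult (int n) (D.psd_of_poly n (L_op n)) (D.psd_of_poly m (monic_op m q)) i -
    D.psd_mult (int m) (D.psd_of_poly m (monic_op m q)) (D.psd_of_poly n (L_op n)) i"
proof -
  let ?h = "subst_Y q"
  have add: "?h (a + b) = ?h a + ?h b" and mult: "?h (a * b) = ?h a * ?h b" for a b
    by (simp_all add: subst_Y_def eval_dpoly_add eval_dpoly_mult)
  have h0: "?h 0 = 0" and h1: "?h 1 = 1"
    using eval_dpoly_const[of "subst_Y_var q" 0] eval_dpoly_const[of "subst_Y_var q" 1]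
    by (simp_all add: subst_Y_def)
  have diff: "?h (a - b) = ?h a - ?h b" for a b
    using add[of "a - b" b] by simp
  have hsum: "?h (\<Sum>i\<in>I. f i) = (\<Sum>i\<in>I. ?h (f i))" for I and f :: "nat \<Rightarrow> dpoly"
    by (induction I rule: infinite_finite_induct) (simp_all add: add h0)
  have map_monic: "map_poly ?h (monic_op N f) = monic_op N (\<lambda>l. ?h (f l))" for N f
    by (rule poly_eqI)
      (simp add: monic_op_def coeff_map_poly h0 add hsum h1 coeff_sum if_distrib[of ?h] cong: if_cong)
  have L: "L_op n = monic_op n (\<lambda>l. var (U l 0))" and P: "P_op m = monic_op m (\<lambda>l. var (Y l 0))"
    by (simp_all add: L_op_def P_op_def monic_op_def)
  have hL: "map_poly ?h (L_op n) = L_op n" and hP: "map_poly ?h (P_op m) = monic_op m q"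
    by (simp_all add: L P map_monic) (simp_all add: subst_Y_def)
  have hom: "map_poly ?h (op_mult D A B) = op_mult D (map_poly ?h A) (map_poly ?h B)" for A B
    by (rule map_poly_op_mult[OF D.derivation_axioms D.derivation_axioms add mult subst_Y_D])
  have "?h (E_coeff n m (n + m - i)) =
    coeff (map_poly ?h (op_mult D (L_op n) (P_op m))) (n + m - i) -
    coeff (map_poly ?h (op_mult D (P_op m) (L_op n))) (n + m - i)"
    by (simp add: E_coeff_def op_commutator_def diff coeff_map_poly h0)
  also have "\<dots> = coeff (op_mult D (L_op n) (monic_op m q)) (n + m - i) -
    coeff (op_mult D (monic_op m q) (L_op n)) (m + n - i)"
    by (simp only: hom hL hP add.commute)
  finally show ?thesis
    using assms D.coeff_op_mult[of "L_op n" n "monic_op m q" m i]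
      D.coeff_op_mult[of "monic_op m q" m "L_op n" n i]
    by (simp add: degree_monic_op L)
qed

section \<open>Existence and uniqueness of the solution\<close>

theorem corollary4p2p1:
  fixes n m :: nat
  assumes "n \<ge> 2" and "m \<ge> 2"
  shows "\<exists>!q. q \<in> {2..m} \<rightarrow>\<^sub>E dpolys_U n
           \<and> (\<forall>l\<in>{2..m}. homogeneous_of_weight l (q l))
           \<and> (\<forall>i\<in>{3..m + 1}. subst_Y q (E_coeff n m (n + m - i)) = 0)"
proof -
  let ?L = "D.psd_of_poly n (L_op n)" and ?P = "\<lambda>q. D.psd_of_poly m (monic_op m q)"
  have L: "?L k = (if k = 0 then 1 else if k \<in> {2..n} then var (U k 0) else 0)" for k
    using psd_of_poly_monic_op[of n "\<lambda>l. var (U l 0)" k] by (simp add: L_op_def monic_op_def)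
  \<comment> \<open>The inverse of \<open>n\<close> serves the root extraction and later cancels
    \<open>n\<close> in the uniqueness argument.\<close>
  define c where "c = const (1 / of_nat n)"
  have of_nat_const: "of_nat k = const (of_nat k)" for k
    by (induction k) (simp_all add: const_add)
  have c: "of_nat n * c = 1"
    using assms by (simp add: c_def of_nat_const flip: const_mult)
  have E: "subst_Y q (E_coeff n m (n + m - Suc k)) =
      D.psd_mult (int n) ?L (?P q) (Suc k) - D.psd_mult (int m) (?P q) ?L (Suc k)"
    if "k \<le> m" for q k
    by (rule subst_Y_E_coeff) (use that assms in simp)
  show ?thesis
  proof (rule ex_ex1I)
    have "D.graded_seq n ?L"
      using const_in_graded_part[of 1 n] by (auto simp: D.graded_seq_def L var_in_graded_part)
    then obtain Q where Q: "D.graded_seq n Q" "Q 0 = 1" "D.psd_pow Q n = ?L"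
      using D.psd_root_exists[of n ?L n c] c by (auto simp: L c_def const_in_graded_part)
    \<comment> \<open>\<open>R\<close> plays the role of \<open>L^(m/n)\<close>.\<close>
    define R where "R = D.psd_pow Q m"
    have R: "R k \<in> graded_part n k" for k
      using D.graded_seq_psd_pow[OF Q(1)] by (simp add: R_def D.graded_seq_def)
    have R0: "R 0 = 1" using Q by (simp add: R_def D.psd_pow_at_0)
    have R1: "R 1 = 0" using R[of 1] by (simp only: graded_part_1) simp
    have comm: "D.psd_mult (int n) ?L R = D.psd_mult (int m) R ?L"
      unfolding R_def Q(3)[symmetric] by (simp only: D.psd_pow_add add.commute)
    define q where "q = restrict R {2..m}"
    \<comment> \<open>Agreement stops at \<open>m\<close>: beyond it \<open>?P q\<close> is zero,
      while \<open>R\<close> may continue with negative powers of \<partial>.\<close>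
    have P: "?P q k = R k" if "k \<le> m" for k
    proof -
      have "k = 0 \<or> k = 1 \<or> k \<in> {2..m}" using that by auto
      then show ?thesis using R0 R1 by (auto simp: psd_of_poly_monic_op q_def)
    qed
    have "subst_Y q (E_coeff n m (n + m - i)) = 0" if i: "i \<in> {3..m + 1}" for i
    proof -
      obtain k where k: "i = Suc k" "k \<le> m" "k > 0" using i by (cases i) auto
      \<comment> \<open>The commutator at \<open>Suc k\<close> does not see the entries at
        \<open>Suc k\<close>, so truncating \<open>R\<close> is harmless even for
        \<open>k = m\<close>.\<close>
      show ?thesis
        using D.psd_commutator_perturb[of k "?P q" R ?L "int n" "int m"] k E[of k q] comm
        by (simp add: P L)
    qed
    moreover have "q \<in> {2..m} \<rightarrow>\<^sub>E dpolys_U n" "\<forall>l\<in>{2..m}. homogeneous_of_weight l (q l)"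
      using R by (auto simp: q_def graded_part_def)
    ultimately show "\<exists>q. q \<in> {2..m} \<rightarrow>\<^sub>E dpolys_U n
           \<and> (\<forall>l\<in>{2..m}. homogeneous_of_weight l (q l))
           \<and> (\<forall>i\<in>{3..m + 1}. subst_Y q (E_coeff n m (n + m - i)) = 0)"
      by blast
  next
    fix q q'
    assume q: "q \<in> {2..m} \<rightarrow>\<^sub>E dpolys_U n \<and> (\<forall>l\<in>{2..m}. homogeneous_of_weight l (q l))
      \<and> (\<forall>i\<in>{3..m + 1}. subst_Y q (E_coeff n m (n + m - i)) = 0)"
      and q': "q' \<in> {2..m} \<rightarrow>\<^sub>E dpolys_U n \<and> (\<forall>l\<in>{2..m}. homogeneous_of_weight l (q' l))
      \<and> (\<forall>i\<in>{3..m + 1}. subst_Y q' (E_coeff n m (n + m - i)) = 0)"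
    \<comment> \<open>Comparing padded sequences makes the indices 0, 1 and those beyond
      \<open>m\<close> agree at once.\<close>
    have "?P q k = ?P q' k" for k
    proof (induction k rule: less_induct)
      case (less k)
      show ?case
      proof (cases "k \<in> {2..m}")
        case True
        then have "k > 0" "k \<le> m" "Suc k \<in> {3..m + 1}" by auto
        \<comment> \<open>Both commutators vanish at \<open>Suc k\<close>, and by the perturbation
          lemma this is their difference.\<close>
        then have "of_nat n * D (q k - q' k) = 0"
          using D.psd_commutator_perturb[of k "?P q" "?P q'" ?L "int n" "int m", OF _ less]
            E[of k q] E[of k q'] q q' True
          by (simp add: L psd_of_poly_monic_op)
        then have "c * of_nat n * D (q k - q' k) = 0" by (simp add: mult.assoc)
        then have "D (q k - q' k) = 0" using c by (simp add: mult.commute)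
        moreover have "q k \<in> graded_part n k" "q' k \<in> graded_part n k"
          using q q' True by (auto simp: graded_part_def PiE_iff)
        then have "homogeneous_of_weight k (q k - q' k)"
          using D.diff_in[of "q k" n k "q' k"] by (simp add: graded_part_def)
        ultimately have "q k - q' k = 0" using \<open>k > 0\<close> by (rule D_eq_0_homogeneous)
        then show ?thesis by (simp add: psd_of_poly_monic_op)
      qed (auto simp: psd_of_poly_monic_op)
    qed
    then have "q l = q' l" if "l \<in> {2..m}" for l
      using that psd_of_poly_monic_op[of m q l] psd_of_poly_monic_op[of m q' l] by simp
    then show "q = q'"
      by (rule PiE_ext[OF conjunct1[OF q] conjunct1[OF q']])
  qed
qed

end
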